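(* Let $\mathcal{A}$ be a finite alphabet with $|\mathcal{A}|\ge 6$. Then Ann has a winning strategy in the erase-repetition game over $\mathcal{A}$: she has a strategy such that, against any strategy of Ben, the length of the shared word is unbounded over the course of the play.
   Context: A square is a word of the form $uu$ with $u$ a non-empty word (any period $|u|\ge1$, including $aa$ for a letter $a$). The erase-repetition game over an alphabet $\mathcal{A}$ is played by Ann and Ben, who, starting from the empty word, alternately append one letter of $\mathcal{A}$ to the end of a shared word, Ann playing first. As soon as a square $uu$ occurs (as a suffix of the current word), the second half $u$ of that square is erased from the word. The goal of Ann is to build arbitrarily long words; Ben tries to keep the length of the word bounded. *)

theory Defs
  imports Main "HOL-Library.FuncSet" "HOL-Library.Sublist"
begin

definition square_half :: "'a list \<Rightarrow> 'a list \<Rightarrow> bool" where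
  "square_half w u \<longleftrightarrow> u \<noteq> [] \<and> suffix (u @ u) w"

definition square_free :: "'a list \<Rightarrow> bool" where
  "square_free w \<longleftrightarrow> \<not> (\<exists>u. u \<noteq> [] \<and> sublist (u @ u) w)"

(* In the game this is only applied to a square-free word extended by one letter. There the
   square suffix is unique (square_half_unique) and the result is square-free again
   (square_free_erase_repetition), so choosing the shortest square only makes the function
   total, and one erasure per move suffices. *)
definition erase_repetition :: "'a list \<Rightarrow> 'a list" where
  "erase_repetition w =
    (if \<exists>u. square_half w u
     then take (length w - length (ARG_MIN length u. square_half w u)) w
     else w)"

lemma square_half_unique_aux:
  assumes sf: "square_free w"
    and u: "square_half (w @ [a]) u" and v: "square_half (w @ [a]) v"
    and less: "length v < length u"
  shows False
proof -
  obtain p where p: "w @ [a] = p @ u @ u" and une: "u \<noteq> []"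
    using u unfolding square_half_def suffix_def by blast
  obtain q where q: "w @ [a] = q @ v @ v" and vne: "v \<noteq> []"
    using v unfolding square_half_def suffix_def by blast
  have no: False if "w @ [a] = r @ x @ x @ s" "x \<noteq> []" "s \<noteq> []" for r x s
  proof -
    have "w = r @ x @ x @ butlast s"
      using arg_cong[OF that(1), of butlast] that(2,3) by (simp add: butlast_append)
    then have "sublist (x @ x) w"
      unfolding sublist_def by (intro exI[of _ r] exI[of _ "butlast s"]) simp
    then show False
      using sf \<open>x \<noteq> []\<close> unfolding square_free_def by blast
  qed
  have "suffix u (w @ [a])"
    unfolding p suffix_def by (intro exI[of _ "p @ u"]) simp
  moreover have "suffix v (w @ [a])"
    unfolding q suffix_def by (intro exI[of _ "q @ v"]) simp
  ultimately have "suffix v u"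
    using less suffix_length_suffix[of v "w @ [a]" u] by simp
  then obtain x where x: "u = x @ v" by (auto simp: suffix_def)
  have xne: "x \<noteq> []" using less x by auto
  have "(p @ u @ x) @ v = w @ [a]"
    unfolding p by (simp add: x)
  also have "\<dots> = (q @ v) @ v"
    unfolding q by simp
  finally have e: "p @ u @ x = q @ v"
    unfolding append_same_eq .
  have xw: "suffix x (q @ v)"
    unfolding e[symmetric] suffix_def by (intro exI[of _ "p @ u"]) simp
  have vw: "suffix v (q @ v)"
    by (simp add: suffix_def)
  show False
  proof (cases "length x \<le> length v")
    case True
    then have "suffix x v"
      using suffix_length_suffix[OF xw vw] by simp
    then obtain y where "v = y @ x" by (auto simp: suffix_def)
    then have "w @ [a] = (p @ x @ y) @ x @ x @ v"
      unfolding p by (simp add: x)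
    from no[OF this xne vne] show False .
  next
    case False
    then have "suffix v x"
      using suffix_length_suffix[OF vw xw] False by simp
    then obtain z where "x = z @ v" by (auto simp: suffix_def)
    then have "w @ [a] = (p @ z) @ v @ v @ u"
      unfolding p by (simp add: x)
    from no[OF this vne une] show False .
  qed
qed

lemma square_half_unique:
  assumes "square_free w" "square_half (w @ [a]) u" "square_half (w @ [a]) v"
  shows "u = v"
proof -
  have "length u = length v"
    using square_half_unique_aux[OF assms] square_half_unique_aux[OF assms(1,3,2)]
    by (cases "length u" "length v" rule: linorder_cases) simp_all
  moreover have "suffix u (w @ [a])" "suffix v (w @ [a])"
    using assms(2,3) unfolding square_half_def by (blast dest: suffix_appendD)+
  ultimately show ?thesis
    using suffix_length_suffix[of u "w @ [a]" v] by (auto simp: suffix_def)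
qed

lemma erase_repetition_square:
  assumes "square_free w" "w @ [a] = p @ u @ u" "u \<noteq> []"
  shows "erase_repetition (w @ [a]) = p @ u"
proof -
  have u: "square_half (w @ [a]) u"
    unfolding square_half_def suffix_def using assms(2,3) by blast
  then have "square_half (w @ [a]) (ARG_MIN length u. square_half (w @ [a]) u)"
    by (rule arg_min_natI)
  then have "(ARG_MIN length u. square_half (w @ [a]) u) = u"
    by (rule square_half_unique[OF assms(1) _ u])
  then have "erase_repetition (w @ [a]) = take (length (w @ [a]) - length u) (w @ [a])"
    unfolding erase_repetition_def using u by metis
  then show ?thesis
    unfolding assms(2) by simp
qed

lemma square_free_erase_repetition:
  assumes "square_free w"
  shows "square_free (erase_repetition (w @ [a]))"
proof (cases "\<exists>u. square_half (w @ [a]) u")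
  case True
  then obtain u p where p: "w @ [a] = p @ u @ u" "u \<noteq> []"
    unfolding square_half_def suffix_def by blast
  have "w = (p @ u) @ butlast u"
    using arg_cong[OF p(1), of butlast] p(2) by (simp add: butlast_append)
  then have "sublist (p @ u) w"
    unfolding sublist_def by (intro exI[of _ "[]"] exI[of _ "butlast u"]) simp
  then have "square_free (p @ u)"
    using assms unfolding square_free_def by (meson sublist_order.order_trans)
  then show ?thesis using erase_repetition_square[OF assms p] by simp
next
  case False
  then have "erase_repetition (w @ [a]) = w @ [a]"
    by (simp add: erase_repetition_def)
  moreover have "square_free (w @ [a])"
    using False assms unfolding square_free_def square_half_def sublist_snoc by blast
  ultimately show ?thesis by simp
qed

definition word_after :: "'a list \<Rightarrow> 'a list" where
  "word_after h = foldl (\<lambda>w a. erase_repetition (w @ [a])) [] h"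

(* A strategy maps the letters played so far (including those since erased) to the next
   letter. *)
definition strategies :: "'a set \<Rightarrow> ('a list \<Rightarrow> 'a) set" where
  "strategies A = lists A \<rightarrow> A"

primrec history :: "('a list \<Rightarrow> 'a) \<Rightarrow> ('a list \<Rightarrow> 'a) \<Rightarrow> nat \<Rightarrow> 'a list" where
  "history \<sigma> \<tau> 0 = []"
| "history \<sigma> \<tau> (Suc n) =
    (let h = history \<sigma> \<tau> n in h @ [if even n then \<sigma> h else \<tau> h])"

definition unbounded_play :: "('a list \<Rightarrow> 'a) \<Rightarrow> ('a list \<Rightarrow> 'a) \<Rightarrow> bool" where
  "unbounded_play \<sigma> \<tau> \<longleftrightarrow> (\<forall>N. \<exists>n. N \<le> length (word_after (history \<sigma> \<tau> n)))"

definition winning_strategy_Ann :: "'a set \<Rightarrow> ('a list \<Rightarrow> 'a) \<Rightarrow> bool" where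
  "winning_strategy_Ann A \<sigma> \<longleftrightarrow>
    \<sigma> \<in> strategies A \<and> (\<forall>\<tau> \<in> strategies A. unbounded_play \<sigma> \<tau>)"

end

theory Submission
  imports Defs
begin

text \<open>
  Call a word of length \<open>2d - 1\<close> with period \<open>d \<ge> 2\<close> an almost square. If Ann
  never repeats the last letter and never completes an almost square, then no square of period
  \<open>d \<ge> 2\<close> ever occurs, neither by her move nor by Ben's next one; all Ben can do to
  hinder growth is to repeat the last letter, which amounts to skipping his turn. The word then
  gains a letter in each round.

  In each turn Ann excludes the last two letters and one further letter, chosen such that the
  periods \<open>2, \<dots>, 5\<close> are taken care of; at least three choices are left. The periods
  \<open>d \<ge> 6\<close> are handled by counting. Fix the replies of Ben and let \<open>C n\<close>
  be the number of good sequences of \<open>n\<close> moves of Ann. As Ben never owns two adjacent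
  letters, an almost square of period \<open>d\<close> determines the last \<open>d div 2\<close>
  moves of Ann, so \<open>C (n + 1) \<ge> 3 C n - 2 (C (n - 2) + \<dots> + C 0)\<close>, whence
  \<open>C (n + 1) \<ge> 2 C n\<close> by induction. So Ben cannot force a bad event within
  \<open>n\<close> rounds for any \<open>n\<close>, and by compactness Ann can avoid bad events forever.

  All words and sequences of moves below are reversed: the head of the list is the last letter.
\<close>

section \<open>Safe moves and short almost squares\<close>

definition almost_square :: "nat \<Rightarrow> 'a list \<Rightarrow> bool" where
  "almost_square d v \<longleftrightarrow> 2 * d \<le> Suc (length v) \<and> (\<forall>i. Suc i < d \<longrightarrow> v ! i = v ! (i + d))"

text \<open>Out-of-range indices yield an arbitrary letter; excluding it does no harm.\<close>

definition guard :: "'a list \<Rightarrow> 'a" where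
  "guard v = (if v ! 0 = v ! 3 then v ! 2
    else if v ! 0 = v ! 4 \<and> v ! 1 = v ! 5 then v ! 3
    else v ! 4)"

definition excluded :: "'a list \<Rightarrow> 'a set" where
  "excluded v = set (take 2 v) \<union> {guard v}"

definition safe :: "'a list \<Rightarrow> 'a \<Rightarrow> bool" where
  "safe v a \<longleftrightarrow> a \<notin> excluded v \<and> (\<forall>d\<ge>6. \<not> almost_square d (a # v))"

definition reply :: "'a list \<Rightarrow> 'a \<Rightarrow> 'a \<Rightarrow> 'a list" where
  "reply v a b = (if b = a then a # v else b # a # v)"

text \<open>The words after complete rounds; rule \<open>Ann\<close> is a round in which Ben repeats
  her letter and loses it.\<close>

inductive reachable :: "'a list \<Rightarrow> bool" where
  Nil: "reachable []"
| Ann: "reachable v \<Longrightarrow> safe v a \<Longrightarrow> reachable (a # v)"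
| Ben: "reachable v \<Longrightarrow> safe v a \<Longrightarrow> b \<noteq> a \<Longrightarrow> reachable (b # a # v)"

lemma reachable_reply: "reachable v \<Longrightarrow> safe v a \<Longrightarrow> reachable (reply v a b)"
  by (auto simp: reply_def intro: reachable.intros)

text \<open>Removing only Ben's letter from a round leaves the word of a round in which he repeated
  Ann's.\<close>

lemma reachable_drop: "reachable v \<Longrightarrow> reachable (drop i v)"
proof (induction arbitrary: i rule: reachable.induct)
  case Nil
  show ?case by (simp add: reachable.Nil)
next
  case (Ann v a)
  then show ?case by (cases i) (auto intro: reachable.Ann)
next
  case (Ben v a b)
  then show ?case
    by (cases i; cases "i - 1") (auto intro: reachable.Ann reachable.Ben)
qed

text \<open>Who wrote a letter: either Ann, or Ben directly on top of a letter of Ann.\<close>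

lemma reachable_nth:
  assumes "reachable v" "i < length v"
  shows "safe (drop (Suc i) v) (v ! i) \<or>
    Suc i < length v \<and> v ! i \<noteq> v ! Suc i \<and> safe (drop (Suc (Suc i)) v) (v ! Suc i)"
proof -
  have "reachable (v ! i # drop (Suc i) v)"
    using reachable_drop[OF assms(1), of i] assms(2) by (simp add: Cons_nth_drop_Suc)
  then show ?thesis
  proof cases
    case (Ben w a)
    then have "Suc i < length v" by (metis drop_all list.distinct(1) not_less)
    with Ben show ?thesis by (simp add: Cons_nth_drop_Suc[symmetric])
  qed simp
qed

lemma safe_nth:
  assumes "safe v a" "i < 2" "i < length v"
  shows "a \<noteq> v ! i"
  using assms unfolding safe_def excluded_def by (auto simp: in_set_conv_nth)

lemma reachable_adjacent:
  assumes "reachable v" "Suc i < length v"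
  shows "v ! i \<noteq> v ! Suc i"
  using reachable_nth[OF assms(1), of i] safe_nth[of "drop (Suc i) v" "v ! i" 0] assms(2) by auto

text \<open>The branches of \<open>guard\<close> aim at the periods 3, 4, 5 in this order; their
  tests are equalities that the almost square forces. As adjacent letters differ, an earlier branch
  interferes only for period 5 with \<open>v ! 0 = v ! 3\<close>, where an earlier move of Ann gives
  the contradiction.\<close>

lemma no_almost_square:
  assumes v: "reachable v" and a: "safe v a" and d: "2 \<le> d"
  shows "\<not> almost_square d (a # v)"
proof
  assume sq: "almost_square d (a # v)"
  then have len: "2 * d \<le> length v + 2" and nth: "\<And>i. Suc i < d \<Longrightarrow> (a # v) ! i = (a # v) ! (i + d)"
    unfolding almost_square_def by auto
  have adj: "v ! i \<noteq> v ! j" if "j = Suc i" "j < length v" for i j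
    using reachable_adjacent[OF v] that by simp
  have g: "a \<noteq> guard v"
    using a by (simp add: safe_def excluded_def)
  consider "d = 2" | "d = 3" | "d = 4" | "d = 5" | "6 \<le> d" using d by linarith
  then show False
  proof cases
    case 1
    then show False using nth[of 0] safe_nth[OF a, of 1] len by simp
  next
    case 2
    then show False using nth[of 0] nth[of 1] g by (simp add: guard_def)
  next
    case 3
    then have e: "a = v ! 3" "v ! 0 = v ! 4" "v ! 1 = v ! 5"
      using nth[of 0] nth[of 1] nth[of 2] by simp_all
    then show False using g adj[of 4 3] len 3 by (simp add: guard_def split: if_splits)
  next
    case 4
    then have e: "a = v ! 4" "v ! 0 = v ! 5" "v ! 1 = v ! 6" "v ! 2 = v ! 7" and l: "8 \<le> length v"
      using nth[of 0] nth[of 1] nth[of 2] nth[of 3] len by simp_all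
    have "v ! 0 = v ! 3"
      using g e adj[of 5 4] l by (auto simp: guard_def split: if_splits)
    define u where "u = drop 3 v"
    have u: "u ! i = v ! (3 + i)" for i
      using l by (simp add: u_def)
    \<comment> \<open>As \<open>v ! 3 = v ! 5\<close>, the letter \<open>v ! 3\<close> is Ben's. So Ann played \<open>v ! 2\<close>, at the word \<open>u\<close>.\<close>
    have "safe u (v ! 2)"
    proof -
      have "1 < length (drop 4 v)" "drop 4 v ! 1 = v ! 3"
        using e(2) \<open>v ! 0 = v ! 3\<close> l by simp_all
      then have "\<not> safe (drop 4 v) (v ! 3)"
        using safe_nth[of "drop 4 v" "v ! 3" 1] by force
      then show ?thesis
        using reachable_nth[OF v, of 2] l by (simp add: u_def)
    qed
    \<comment> \<open>The first two branches would force \<open>v ! 5 = v ! 6\<close> and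
      \<open>v ! 2 = v ! 3\<close>. So \<open>v ! 2 = v ! 7\<close> was excluded when Ann played
      it.\<close>
    moreover have "guard u = v ! 7"
      using e \<open>v ! 0 = v ! 3\<close> adj[of 6 5] adj[of 3 2] l by (simp add: guard_def u)
    ultimately show False using e by (simp add: safe_def excluded_def)
  next
    case 5
    then show False using a sq by (simp add: safe_def)
  qed
qed


section \<open>Counting good sequences of moves\<close>

text \<open>
  Ben is given by \<open>g k w\<close>, his letter after \<open>k\<close> complete rounds when Ann's move
  has led to the word \<open>w\<close>.
\<close>

primrec position :: "(nat \<Rightarrow> 'a list \<Rightarrow> 'a) \<Rightarrow> 'a list \<Rightarrow> 'a list" where
  "position g [] = []"
| "position g (a # s) = reply (position g s) a (g (length s) (a # position g s))"

primrec good :: "'a set \<Rightarrow> (nat \<Rightarrow> 'a list \<Rightarrow> 'a) \<Rightarrow> 'a list \<Rightarrow> bool" where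
  "good A g [] \<longleftrightarrow> True"
| "good A g (a # s) \<longleftrightarrow> good A g s \<and> a \<in> A \<and> safe (position g s) a"

definition good_moves :: "'a set \<Rightarrow> (nat \<Rightarrow> 'a list \<Rightarrow> 'a) \<Rightarrow> nat \<Rightarrow> 'a list set" where
  "good_moves A g n = {s. length s = n \<and> good A g s}"

lemma good_drop: "good A g s \<Longrightarrow> good A g (drop k s)"
  by (induction s arbitrary: k) (auto simp: drop_Cons split: nat.split)

lemma good_subset: "good A g s \<Longrightarrow> set s \<subseteq> A"
  by (induction s) auto

lemma finite_good_moves:
  assumes "finite A"
  shows "finite (good_moves A g n)"
  by (rule finite_subset[OF _ finite_lists_length_eq[OF assms, of n]])
    (auto simp: good_moves_def dest: good_subset)

lemma length_position: "length (position g s) \<le> 2 * length s"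
  by (induction s) (auto simp: reply_def)

text \<open>Each of the \<open>k\<close> later rounds adds at most two letters, and Ben's reply to
  \<open>t ! k\<close> at most one.\<close>

lemma position_split:
  "k < length t \<Longrightarrow>
    \<exists>y. position g t = y @ t ! k # position g (drop (Suc k) t) \<and> length y \<le> 2 * k + 1"
proof (induction t arbitrary: k)
  case (Cons a s)
  show ?case
  proof (cases k)
    case 0
    then show ?thesis
      by (auto simp: reply_def intro: exI[of _ "[]"] exI[of _ "[_]"])
  next
    case (Suc l)
    then obtain y where y: "position g s = y @ s ! l # position g (drop (Suc l) s)"
      "length y \<le> 2 * l + 1"
      using Cons by auto
    define b where "b = g (length s) (a # position g s)"
    show ?thesis
      using y Suc unfolding position.simps b_def[symmetric]
      by (auto simp: reply_def intro: exI[of _ "a # y"] exI[of _ "b # a # y"])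
  qed
qed simp

definition bad_moves :: "'a set \<Rightarrow> (nat \<Rightarrow> 'a list \<Rightarrow> 'a) \<Rightarrow> nat \<Rightarrow> nat \<Rightarrow> 'a list set" where
  "bad_moves A g n d = {a # s |a s. s \<in> good_moves A g n \<and> a \<in> A \<and> almost_square d (a # position g s)}"

text \<open>Ben has not yet answered the last move, so fewer than \<open>d - 1\<close> letters lie
  above \<open>t ! k\<close>. The period equates it with the letter \<open>d\<close> places deeper,
  which was there before that move.\<close>

lemma bad_moves_nth:
  assumes t: "t \<in> bad_moves A g n d" and d: "2 \<le> d"
  shows "d div 2 \<le> Suc n"
    and "k < d div 2 \<Longrightarrow> t ! k = position g (drop (Suc k) t) ! (d - 1)"
proof -
  obtain a s where as: "t = a # s" "length s = n" and sq: "almost_square d (a # position g s)"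
    using t by (auto simp: bad_moves_def good_moves_def)
  show le: "d div 2 \<le> Suc n"
    using sq length_position[of g s] as d unfolding almost_square_def by auto
  assume k: "k < d div 2"
  have "\<exists>y. a # position g s = y @ t ! k # position g (drop (Suc k) t) \<and> length y \<le> 2 * k"
  proof (cases k)
    case 0
    then show ?thesis by (simp add: as)
  next
    case (Suc l)
    then obtain y where "position g s = y @ s ! l # position g (drop (Suc l) s)"
      "length y \<le> 2 * l + 1"
      using position_split[of l s g] k le as by auto
    then show ?thesis
      using Suc as by (intro exI[of _ "a # y"]) auto
  qed
  then obtain y where y: "a # position g s = y @ t ! k # position g (drop (Suc k) t)"
    and ly: "length y \<le> 2 * k" by blast
  have "Suc (length y) < d" using ly k by linarith
  then have "(a # position g s) ! length y = (a # position g s) ! (length y + d)"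
    using sq unfolding almost_square_def by blast
  then show "t ! k = position g (drop (Suc k) t) ! (d - 1)"
    unfolding y using d by (simp add: nth_append nth_Cons')
qed

lemma card_bad_moves:
  assumes A: "finite A" and d: "2 \<le> d"
  shows "card (bad_moves A g n d) \<le> card (good_moves A g (Suc n - d div 2))"
proof (rule card_inj_on_le)
  show "finite (good_moves A g (Suc n - d div 2))"
    by (rule finite_good_moves[OF A])
  show "drop (d div 2) ` bad_moves A g n d \<subseteq> good_moves A g (Suc n - d div 2)"
  proof -
    obtain j where j: "d div 2 = Suc j" using d by (cases "d div 2") auto
    show ?thesis
      unfolding j by (auto simp: bad_moves_def good_moves_def intro: good_drop)
  qed
  show "inj_on (drop (d div 2)) (bad_moves A g n d)"
  proof (rule inj_onI)
    fix t u
    assume t: "t \<in> bad_moves A g n d" and u: "u \<in> bad_moves A g n d"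
      and eq: "drop (d div 2) t = drop (d div 2) u"
    have len: "length t = Suc n" "length u = Suc n"
      using t u by (auto simp: bad_moves_def good_moves_def)
    \<comment> \<open>The dropped moves are recovered from the oldest to the newest, each from the
      position before it.\<close>
    have "drop (d div 2 - i) t = drop (d div 2 - i) u" for i
    proof (induction i)
      case (Suc i)
      show ?case
      proof (cases "i < d div 2")
        case True
        define k where "k = d div 2 - Suc i"
        have k: "k < d div 2" "d div 2 - i = Suc k"
          using True by (simp_all add: k_def)
        have "k < Suc n"
          using k bad_moves_nth(1)[OF t d] by simp
        then show ?thesis
          unfolding k_def[symmetric]
          using Suc.IH bad_moves_nth(2)[OF t d k(1)] bad_moves_nth(2)[OF u d k(1)] len k(2)
          by (simp add: Cons_nth_drop_Suc[symmetric])
      qed (use Suc in simp)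
    qed (simp add: eq)
    from this[of "d div 2"] show "t = u" by simp
  qed
qed

lemma card_excluded: "card (excluded v) \<le> 3"
proof -
  have "card (set (take 2 v)) \<le> 2"
    by (rule order_trans[OF card_length]) simp
  then show ?thesis
    unfolding excluded_def using card_Un_le[of "set (take 2 v)" "{guard v}"] by simp
qed

text \<open>Each good sequence has at least 6 - 3 extensions outside \<open>excluded\<close>; those
  that are not good lie in \<open>B\<close>. The periods \<open>2 * j\<close> and
  \<open>Suc (2 * j)\<close> both determine the last \<open>j\<close> moves, hence the factor
  2.\<close>

lemma card_good_moves_Suc:
  assumes A: "finite A" "6 \<le> card A"
  shows "3 * card (good_moves A g n) \<le>
    card (good_moves A g (Suc n)) + 2 * (\<Sum>i<n - 1. card (good_moves A g i))"
proof -
  define E where "E = (\<lambda>(s, a). a # s) ` (SIGMA s:good_moves A g n. A - excluded (position g s))"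
  define B where "B = (\<Union>j\<in>{3..Suc n}. bad_moves A g n (2 * j) \<union> bad_moves A g n (Suc (2 * j)))"
  have fin: "finite (good_moves A g m)" for m
    by (rule finite_good_moves[OF A(1)])
  have "3 * card (good_moves A g n) \<le> (\<Sum>s\<in>good_moves A g n. card (A - excluded (position g s)))"
  proof -
    have "3 \<le> card (A - excluded (position g s))" for s
      using diff_card_le_card_Diff[of "excluded (position g s)" A] card_excluded[of "position g s"] A(2)
      by (simp add: excluded_def)
    then have "(\<Sum>s\<in>good_moves A g n. 3) \<le> (\<Sum>s\<in>good_moves A g n. card (A - excluded (position g s)))"
      by (intro sum_mono)
    then show ?thesis by simp
  qed
  also have "\<dots> = card E"
    unfolding E_def using fin A(1)
    by (subst card_image) (auto simp: inj_on_def)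
  also have "E \<subseteq> good_moves A g (Suc n) \<union> B"
  proof
    fix t assume "t \<in> E"
    then obtain s a where t: "t = a # s" "s \<in> good_moves A g n" "a \<in> A"
      "a \<notin> excluded (position g s)"
      unfolding E_def by auto
    show "t \<in> good_moves A g (Suc n) \<union> B"
    proof (cases "safe (position g s) a")
      case True
      then show ?thesis using t by (simp add: good_moves_def)
    next
      case False
      then obtain d where d: "6 \<le> d" "almost_square d (a # position g s)"
        using t(4) by (auto simp: safe_def)
      then have bad: "t \<in> bad_moves A g n d"
        using t by (auto simp: bad_moves_def)
      then have "d div 2 \<in> {3..Suc n}"
        using bad_moves_nth(1) d(1) by fastforce
      moreover have "d = 2 * (d div 2) \<or> d = Suc (2 * (d div 2))" by presburger
      ultimately show ?thesis
        using bad unfolding B_def by (metis UN_iff UnCI)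
    qed
  qed
  then have "card E \<le> card (good_moves A g (Suc n) \<union> B)"
  proof (rule card_mono[rotated])
    have "finite (bad_moves A g n d)" for d
      by (rule finite_subset[of _ "(\<lambda>(a, s). a # s) ` (A \<times> good_moves A g n)"])
        (use A(1) fin in \<open>auto simp: bad_moves_def\<close>)
    then show "finite (good_moves A g (Suc n) \<union> B)"
      using fin by (simp add: B_def)
  qed
  also have "\<dots> \<le> card (good_moves A g (Suc n)) + card B"
    by (rule card_Un_le)
  also have "card B \<le> (\<Sum>j\<in>{3..Suc n}. 2 * card (good_moves A g (Suc n - j)))"
  proof -
    have "card (bad_moves A g n (2 * j) \<union> bad_moves A g n (Suc (2 * j)))
        \<le> 2 * card (good_moves A g (Suc n - j))" if "j \<in> {3..Suc n}" for j
      using card_bad_moves[OF A(1), of "2 * j" g n] card_bad_moves[OF A(1), of "Suc (2 * j)" g n]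
        card_Un_le[of "bad_moves A g n (2 * j)" "bad_moves A g n (Suc (2 * j))"] that
      by simp
    then show ?thesis
      unfolding B_def by (intro order_trans[OF card_UN_le] sum_mono) auto
  qed
  also have "(\<Sum>j\<in>{3..Suc n}. 2 * card (good_moves A g (Suc n - j))) =
      (\<Sum>i<n - 1. 2 * card (good_moves A g i))"
    by (rule sum.reindex_bij_witness[of _ "\<lambda>i. Suc n - i" "\<lambda>j. Suc n - j"]) auto
  also have "\<dots> = 2 * (\<Sum>i<n - 1. card (good_moves A g i))"
    by (simp add: sum_distrib_left)
  finally show ?thesis by simp
qed

text \<open>By doubling below \<open>n\<close>, the sum over \<open>i < n - 1\<close> is at most the
  count at \<open>n - 1\<close>, so its double is at most the count at \<open>n\<close> (for
  \<open>n = 0\<close> the sum is empty). This leaves 3 - 1 = 2.\<close>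

lemma card_good_moves_double:
  assumes A: "finite A" "6 \<le> card A"
  shows "2 * card (good_moves A g n) \<le> card (good_moves A g (Suc n))"
proof (induction n rule: less_induct)
  case (less n)
  have sum: "(\<Sum>i<m. card (good_moves A g i)) \<le> card (good_moves A g m)" if "m \<le> n" for m
    using that
  proof (induction m)
    case (Suc m)
    then show ?case using less.IH[of m] by simp
  qed simp
  have "2 * (\<Sum>i<n - 1. card (good_moves A g i)) \<le> card (good_moves A g n)"
    using sum[of "n - 1"] less.IH[of "n - 1"] by (cases n) auto
  then show ?case
    using card_good_moves_Suc[OF A, of g n] by linarith
qed

lemma good_moves_nonempty:
  assumes "finite A" "6 \<le> card A"
  shows "good_moves A g n \<noteq> {}"
proof -
  have "0 < card (good_moves A g n)"
  proof (induction n)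
    case 0
    have "good_moves A g 0 = {[]}" by (auto simp: good_moves_def)
    then show ?case by simp
  next
    case (Suc n)
    then show ?case using card_good_moves_double[OF assms, of g n] by linarith
  qed
  then show ?thesis by auto
qed

section \<open>From finite horizons to endless play\<close>

primrec survives :: "'a set \<Rightarrow> nat \<Rightarrow> 'a list \<Rightarrow> bool" where
  "survives A 0 v \<longleftrightarrow> True"
| "survives A (Suc n) v \<longleftrightarrow> (\<exists>a\<in>A. safe v a \<and> (\<forall>b\<in>A. survives A n (reply v a b)))"

lemma survives_antimono: "survives A n v \<Longrightarrow> m \<le> n \<Longrightarrow> survives A m v"
proof (induction n arbitrary: m v)
  case (Suc n)
  then show ?case by (cases m) auto
qed simp

text \<open>Otherwise Ben has replies that keep every position lost; against them, a good sequence
  of length \<open>n\<close> would end in a position lost with no rounds to go.\<close>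

lemma survives_Nil:
  assumes A: "finite A" "6 \<le> card A"
  shows "survives A n []"
proof (rule ccontr)
  assume lost: "\<not> survives A n []"
  \<comment> \<open>\<open>w\<close> is the word just after Ann's move: \<open>hd w\<close> is the
    move and \<open>tl w\<close> the position before it.\<close>
  define g where "g k w = (SOME b. b \<in> A \<and> \<not> survives A (n - Suc k) (reply (tl w) (hd w) b))" for k w
  have "\<not> survives A (n - length s) (position g s)" if "good A g s" "length s \<le> n" for s
    using that
  proof (induction s)
    case (Cons a s)
    then have "\<not> survives A (Suc (n - Suc (length s))) (position g s)"
      by (simp add: Suc_diff_Suc)
    then have "\<exists>b. b \<in> A \<and> \<not> survives A (n - Suc (length s)) (reply (position g s) a b)"
      using Cons.prems by auto
    then have "\<not> survives A (n - Suc (length s))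
        (reply (position g s) a (g (length s) (a # position g s)))"
      unfolding g_def list.sel by (rule someI2_ex) simp
    then show ?case by simp
  qed (use lost in simp)
  moreover obtain s where "good A g s" "length s = n"
    using good_moves_nonempty[OF A, of g n] by (auto simp: good_moves_def)
  ultimately show False by fastforce
qed

text \<open>Compactness: if every safe move failed at some horizon, then, \<open>A\<close> being
  finite, all would fail at the largest of these.\<close>

lemma survives_forever_step:
  assumes A: "finite A" and v: "\<And>n. survives A n v"
  shows "\<exists>a\<in>A. safe v a \<and> (\<forall>b\<in>A. \<forall>n. survives A n (reply v a b))"
proof (rule ccontr)
  assume "\<not> ?thesis"
  then have "\<forall>a\<in>A. \<exists>n. safe v a \<longrightarrow> (\<exists>b\<in>A. \<not> survives A n (reply v a b))"
    by blast
  then obtain N where N: "\<And>a. a \<in> A \<Longrightarrow> safe v a \<Longrightarrow> \<exists>b\<in>A. \<not> survives A (N a) (reply v a b)"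
    by metis
  obtain a where a: "a \<in> A" "safe v a" "\<forall>b\<in>A. survives A (Max (N ` A)) (reply v a b)"
    using v[of "Suc (Max (N ` A))"] by auto
  have "N a \<le> Max (N ` A)"
    using A a(1) by simp
  with N[OF a(1,2)] a(3) show False
    using survives_antimono by blast
qed

section \<open>Translation to the game\<close>

lemma square_half_rev_nth:
  assumes "square_half (rev v) u" "i < length u"
  shows "v ! i = v ! (i + length u)"
proof -
  obtain p where "rev v = p @ u @ u"
    using assms(1) unfolding square_half_def suffix_def by blast
  then have "v = rev u @ rev u @ rev p"
    by (metis append.assoc rev_append rev_rev_ident)
  then show ?thesis using assms(2) by (simp add: nth_append)
qed

lemma square_half_length: "square_half w u \<Longrightarrow> 0 < length u \<and> 2 * length u \<le> length w"
  unfolding square_half_def suffix_def by auto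

lemma erase_repetition_Ann:
  assumes v: "reachable v" "safe v a"
  shows "erase_repetition (rev v @ [a]) = rev v @ [a]"
proof -
  have False if "square_half (rev (a # v)) u" for u
  proof (cases "length u = 1")
    case True
    then show False
      using square_half_rev_nth[OF that, of 0] square_half_length[OF that] safe_nth[OF v(2), of 0]
      by (cases v) auto
  next
    case False
    have "almost_square (length u) (a # v)"
      using square_half_rev_nth[OF that] square_half_length[OF that]
      by (auto simp: almost_square_def)
    moreover have "2 \<le> length u"
      using False square_half_length[OF that] by linarith
    ultimately show False
      using no_almost_square[OF v] by blast
  qed
  then show ?thesis by (auto simp: erase_repetition_def)
qed

lemma erase_repetition_Ben:
  assumes v: "reachable v" "safe v a" and sf: "square_free (rev (a # v))"
  shows "erase_repetition (rev (a # v) @ [b]) = rev (reply v a b)"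
proof (cases "b = a")
  case True
  then show ?thesis
    using erase_repetition_square[OF sf, of a "rev v" "[a]"] by (simp add: reply_def)
next
  case False
  have False if "square_half (rev (b # a # v)) u" for u
  proof (cases "length u = 1")
    case True
    then show False
      using square_half_rev_nth[OF that, of 0] \<open>b \<noteq> a\<close> by simp
  next
    case False
    \<comment> \<open>Without Ben's letter the square leaves an almost square ending in Ann's
      move.\<close>
    have "(a # v) ! i = (a # v) ! (i + length u)" if "Suc i < length u" for i
      using square_half_rev_nth[OF \<open>square_half _ u\<close> that] by simp
    then have "almost_square (length u) (a # v)"
      using square_half_length[OF that] by (simp add: almost_square_def)
    moreover have "2 \<le> length u"
      using False square_half_length[OF that] by linarith
    ultimately show False
      using no_almost_square[OF v] by blast
  qed
  then show ?thesis using False by (auto simp: erase_repetition_def reply_def)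
qed

lemma word_after_snoc: "word_after (h @ [a]) = erase_repetition (word_after h @ [a])"
  by (simp add: word_after_def)

lemma history_in_lists:
  assumes "\<sigma> \<in> strategies A" "\<tau> \<in> strategies A"
  shows "history \<sigma> \<tau> n \<in> lists A"
  using assms by (induction n) (auto simp: Let_def strategies_def Pi_iff)

theorem theorem2:
  fixes A :: "'a set"
  assumes "finite A" and "card A \<ge> 6"
  shows "\<exists>\<sigma>. winning_strategy_Ann A \<sigma>"
proof -
  define W where "W v \<longleftrightarrow> (\<forall>n. survives A n v)" for v
  define Q where "Q v a \<longleftrightarrow> a \<in> A \<and> safe v a \<and> (\<forall>b\<in>A. W (reply v a b))" for v a
  \<comment> \<open>The move depends on the current word alone; the last choice is a default that
    keeps the values in \<open>A\<close>.\<close>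
  define \<sigma> where "\<sigma> h = (let v = rev (word_after h) in
    if \<exists>a. Q v a then SOME a. Q v a else SOME a. a \<in> A)" for h
  have Q: "Q v (SOME a. Q v a)" if "\<exists>a. Q v a" for v
    using that by (rule someI_ex)
  have "(SOME a. a \<in> A) \<in> A"
    using assms(2) by (auto simp: some_in_eq)
  moreover have "(SOME a. Q v a) \<in> A" if "\<exists>a. Q v a" for v
    using Q[OF that] unfolding Q_def[of v "SOME a. Q v a"] by blast
  ultimately have \<sigma>: "\<sigma> \<in> strategies A"
    by (simp add: strategies_def \<sigma>_def Let_def)
  have "unbounded_play \<sigma> \<tau>" if \<tau>: "\<tau> \<in> strategies A" for \<tau>
  proof -
    \<comment> \<open>Each round keeps at least Ann's new letter, whence the bound
      \<open>m\<close>.\<close>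
    have inv: "\<exists>v. word_after (history \<sigma> \<tau> (2 * m)) = rev v \<and> reachable v \<and> W v
        \<and> square_free (rev v) \<and> m \<le> length v" for m
    proof (induction m)
      case 0
      have "square_free []" by (simp add: square_free_def)
      then show ?case
        using survives_Nil[OF assms] by (auto simp: word_after_def W_def intro: reachable.Nil)
    next
      case (Suc m)
      define h where "h = history \<sigma> \<tau> (2 * m)"
      obtain v where v: "word_after h = rev v" "reachable v" "W v" "square_free (rev v)" "m \<le> length v"
        using Suc unfolding h_def by blast
      define a where "a = \<sigma> h"
      define b where "b = \<tau> (h @ [a])"
      have "\<exists>a. Q v a"
        using survives_forever_step[OF assms(1), of v] v(3) unfolding W_def Q_def by blast
      then have a: "Q v a"
        using Q by (simp add: a_def \<sigma>_def v(1))
      have h: "h \<in> lists A" "h @ [a] \<in> lists A"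
        using history_in_lists[OF \<sigma> \<tau>] a unfolding h_def Q_def by auto
      have b: "b \<in> A"
        using \<tau> h(2) unfolding b_def strategies_def by blast
      have hist: "history \<sigma> \<tau> (2 * Suc m) = (h @ [a]) @ [b]"
        by (simp add: Let_def h_def a_def b_def)
      have safe: "safe v a" using a by (simp add: Q_def)
      have wa: "word_after (h @ [a]) = rev (a # v)"
        using erase_repetition_Ann[OF v(2) safe] by (simp add: word_after_snoc v(1))
      have sfa: "square_free (rev (a # v))"
        using square_free_erase_repetition[OF v(4), of a] erase_repetition_Ann[OF v(2) safe] by simp
      have wb: "word_after ((h @ [a]) @ [b]) = rev (reply v a b)"
        using erase_repetition_Ben[OF v(2) safe sfa] by (simp only: word_after_snoc[of "h @ [a]"] wa)
      have sfb: "square_free (rev (reply v a b))"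
        using square_free_erase_repetition[OF sfa, of b] erase_repetition_Ben[OF v(2) safe sfa] by simp
      show ?case
        unfolding hist wb
        using sfb reachable_reply[OF v(2) safe, of b] a b v(5)
        by (intro exI[of _ "reply v a b"]) (auto simp: Q_def reply_def)
    qed
    show ?thesis
      unfolding unbounded_play_def
    proof
      fix N
      obtain v where "word_after (history \<sigma> \<tau> (2 * N)) = rev v" "N \<le> length v"
        using inv[of N] by blast
      then show "\<exists>n. N \<le> length (word_after (history \<sigma> \<tau> n))"
        by (intro exI[of _ "2 * N"]) simp
    qed
  qed
  then show ?thesis
    using \<sigma> unfolding winning_strategy_Ann_def by blast
qed

end
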